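(* Let $p$ be a prime, $q=p^{r}$, $F=\mathrm{GF}(q)$, $k\geq 3$ a divisor of $q-1$, $m=(q-1)/k$, $\zeta$ a generator of $F^{*}$, $\varphi=\zeta^{m}$ and $\Phi=\langle\varphi\rangle$ the subgroup of order $k$. Put \[ s=\sum_{j=1}^{k-1}\bigl|(\Phi+1)\cap(\Phi+\varphi^{j})\bigr|,\qquad t=|\Phi\cap(\Phi+1)|. \] Assume $(p,k)$ is circular. Then the number of solutions $(x,y,z)\in F^{3}$ of $x^{m}+y^{m}-z^{m}=1$ is \[ \begin{cases} m^{3}(k+s)+3m^{2}t+2m, & \text{if } k \text{ is odd and } p\neq 2;\\ m^{3}(k+s)+3m^{2}t+3m, & \text{if } k \text{ is even or } p=2.\end{cases} \]
   Context: For a finite field $E$ and its multiplicative subgroup $\Psi$ of order $k$, the pair $(E,\Psi)$ is circular if $|\Psi a\cap(\Psi b+c)|\leq 2$ for all $a,b,c\in E^{*}$. The pair $(p,k)$ is called circular if $(\mathrm{GF}(p^{r'}),\Psi)$ is circular for some $r'\in\mathbb{N}$ with $k\mid(p^{r'}-1)$; it is known (Modisett) that then $(\mathrm{GF}(p^{r}),\Phi)$ is circular for every $r$ with $k\mid(p^{r}-1)$. *)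

theory Defs
  imports "HOL-Algebra.Multiplicative_Group" "HOL-Computational_Algebra.Primes"
begin

definition is_GF :: "('a, 'b) ring_scheme \<Rightarrow> nat \<Rightarrow> bool"
  where "is_GF E q \<longleftrightarrow> field E \<and> finite (carrier E) \<and> order E = q"

definition circular :: "('a, 'b) ring_scheme \<Rightarrow> 'a set \<Rightarrow> bool"
  where "circular E \<Psi> \<longleftrightarrow>
    (\<forall>a \<in> carrier E - {\<zero>\<^bsub>E\<^esub>}. \<forall>b \<in> carrier E - {\<zero>\<^bsub>E\<^esub>}. \<forall>c \<in> carrier E - {\<zero>\<^bsub>E\<^esub>}.
      card ((\<Psi> #>\<^bsub>E\<^esub> a) \<inter> ((\<Psi> #>\<^bsub>E\<^esub> b) +>\<^bsub>E\<^esub> c)) \<le> 2)"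

text \<open>
  Existence of a field cannot be quantified over types, so the field ranges over rings whose
  carrier is a set of natural numbers. This loses nothing: every finite field is isomorphic to one
  of this form, and circularity is invariant under isomorphism. A finite field has exactly
  one multiplicative subgroup of each order dividing the order of its unit group, so it makes no
  difference that \<open>\<Psi>\<close> is existentially quantified.
\<close>

definition circular_pair :: "nat \<Rightarrow> nat \<Rightarrow> bool"
  where "circular_pair p k \<longleftrightarrow>
    (\<exists>r \<ge> 1. k dvd p ^ r - 1 \<and>
      (\<exists>(E :: nat ring) \<Psi>. is_GF E (p ^ r) \<and>
        subgroup \<Psi> (Multiplicative_Group.mult_of E) \<and> card \<Psi> = k \<and> circular E \<Psi>))"

end

theory Submission
  imports Defs
begin

text \<open>
  The map \<open>x \<mapsto> x\<^sup>m\<close> sends \<open>F\<^sup>*\<close> onto \<open>\<Phi>\<close> with fibres of size \<open>m\<close>, and \<open>0\<close> only to \<open>0\<close>. So the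
  solutions are counted by those of \<open>u + v - w = 1\<close> in \<open>\<Phi> \<union> {0}\<close>, each weighted by \<open>m\<close> to the
  number of nonzero entries. With no entry zero, rewrite the equation as \<open>u + v = w + 1\<close>: for fixed
  \<open>v\<close> it has \<open>|(\<Phi> + 1) \<inter> (\<Phi> + v)|\<close> solutions, which is \<open>k\<close> for \<open>v = 1\<close>, giving \<open>k + s\<close> in all.
  With exactly one entry zero there are \<open>t\<close> solutions for each position. With two entries zero there
  are the solutions \<open>u = 1\<close> and \<open>v = 1\<close>, and \<open>w = -1\<close> exactly when \<open>-1 \<in> \<Phi>\<close>.
\<close>

section \<open>Counting residues and counting triples by fibres\<close>

lemma card_mod_class:
  fixes j k m :: nat
  assumes "j < k"
  shows "card {i \<in> {..<k * m}. i mod k = j} = m"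
proof -
  have "{i \<in> {..<k * m}. i mod k = j} = (\<lambda>i. j + k * i) ` {..<m}"
  proof (intro equalityI subsetI)
    fix i assume i: "i \<in> {i \<in> {..<k * m}. i mod k = j}"
    then have "i = j + k * (i div k)" "i div k < m"
      using mod_mult_div_eq[of i k] by (auto simp: less_mult_imp_div_less mult.commute)
    then show "i \<in> (\<lambda>i. j + k * i) ` {..<m}" by blast
  next
    fix i assume "i \<in> (\<lambda>i. j + k * i) ` {..<m}"
    then obtain l where l: "l < m" "i = j + k * l" by auto
    \<comment> \<open>Together with \<open>j < k\<close> this bounds \<open>j + k * l\<close>
      strictly below \<open>k * m\<close>.\<close>
    have "k * l + k \<le> k * m" using l(1) by (metis Suc_leI mult_Suc_right mult_le_mono2 add.commute)
    then show "i \<in> {i \<in> {..<k * m}. i mod k = j}" using l assms by auto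
  qed
  moreover have "inj_on (\<lambda>i. j + k * i) {..<m}" using assms by (auto simp: inj_on_def)
  ultimately show ?thesis by (simp add: card_image)
qed

text \<open>The triples lying over a given \<open>(u, v, w)\<close> form the product of three
  fibres, and distinct \<open>(u, v, w)\<close> give disjoint products. This supplies the weights
  attached to solutions in \<Phi> with zero adjoined.\<close>

lemma card_triples_by_fibres:
  assumes "finite A" "finite B" "f ` A \<subseteq> B"
  shows "card {(x, y, z) \<in> A \<times> A \<times> A. P (f x) (f y) (f z)}
    = (\<Sum>(u, v, w) \<in> {(u, v, w) \<in> B \<times> B \<times> B. P u v w}.
        card {x \<in> A. f x = u} * card {x \<in> A. f x = v} * card {x \<in> A. f x = w})"
proof -
  let ?T = "{(u, v, w) \<in> B \<times> B \<times> B. P u v w}"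
  let ?fib = "\<lambda>u. {x \<in> A. f x = u}"
  have "{(x, y, z) \<in> A \<times> A \<times> A. P (f x) (f y) (f z)}
      = (\<Union>t\<in>?T. case t of (u, v, w) \<Rightarrow> ?fib u \<times> ?fib v \<times> ?fib w)"
    using assms(3) by (auto simp: image_subset_iff)
  also have "card \<dots> = (\<Sum>t\<in>?T. card (case t of (u, v, w) \<Rightarrow> ?fib u \<times> ?fib v \<times> ?fib w))"
  proof (rule card_UN_disjoint)
    have "?T \<subseteq> B \<times> B \<times> B" by auto
    then show "finite ?T" using assms(2) by (meson finite_SigmaI finite_subset)
  qed (use assms(1) in auto)
  also have "\<dots> = (\<Sum>(u, v, w) \<in> ?T. card (?fib u) * card (?fib v) * card (?fib w))"
    by (rule sum.cong) (auto simp: card_cartesian_product)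
  finally show ?thesis .
qed

section \<open>The cyclic unit group and its subgroup \<Phi>\<close>

locale finite_field_gen = field R for R (structure) +
  fixes \<zeta> :: 'a and k m :: nat
  assumes finite_R: "finite (carrier R)"
    and gen_carrier: "\<zeta> \<in> carrier R - {\<zero>}"
    and gen: "generate (mult_of R) {\<zeta>} = carrier R - {\<zero>}"
    and order_eq: "order R - 1 = k * m"
    and k_pos: "k > 0" and m_pos: "m > 0"
begin

text \<open>The rewrites let group theory of the unit group be read with the operations of
  \<open>R\<close>. Inverses are not among them, so they are converted where they occur.\<close>

sublocale M: group "mult_of R"
  rewrites "carrier (mult_of R) = carrier R - {\<zero>}"
    and "monoid.mult (mult_of R) = monoid.mult R"
    and "\<one>\<^bsub>mult_of R\<^esub> = \<one>"
    and "([^]\<^bsub>mult_of R\<^esub>) = (([^]) :: 'a \<Rightarrow> nat \<Rightarrow> 'a)"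
  by (simp_all add: field_mult_group nat_pow_mult_of)

definition \<phi> where "\<phi> = \<zeta> [^] m"
definition \<Phi> where "\<Phi> = generate (mult_of R) {\<phi>}"

lemma ord_\<zeta>: "M.ord \<zeta> = k * m"
  using M.generate_pow_card[OF gen_carrier] gen order_mult_of[OF finite_R] order_eq
  by (simp add: order_def)

lemma \<phi>_carrier: "\<phi> \<in> carrier R - {\<zero>}"
  unfolding \<phi>_def using gen_carrier M.nat_pow_closed by blast

lemma ord_\<phi>: "M.ord \<phi> = k"
  unfolding \<phi>_def using M.ord_pow[OF gen_carrier, of m] m_pos by (simp add: ord_\<zeta>)

text \<open>Exponents below the order list a cyclic group without repetition. For \<zeta> this
  parametrises all units, for \<phi> the subgroup \<Phi>.\<close>

lemma powers:
  assumes a: "a \<in> carrier R - {\<zero>}"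
  shows "generate (mult_of R) {a} = (\<lambda>i. a [^] i) ` {..<M.ord a}"
    and "inj_on (\<lambda>i::nat. a [^] i) {..<M.ord a}"
proof -
  have fin: "finite (carrier R - {\<zero>})" using finite_R by simp
  \<comment> \<open>Positivity matters for the interval: for order 0, truncated subtraction would
    give \<open>{0}\<close> rather than the empty set.\<close>
  have "M.ord a \<ge> 1" using M.ord_ge_1[OF fin a] .
  then have *: "{0..M.ord a - 1} = {..<M.ord a}" by auto
  show "inj_on (\<lambda>i::nat. a [^] i) {..<M.ord a}" using M.ord_inj[OF a] * by simp
  show "generate (mult_of R) {a} = (\<lambda>i. a [^] i) ` {..<M.ord a}"
    using M.generate_pow_on_finite_carrier[OF fin a] M.ord_elems[OF fin a] *
    by (auto simp: image_def)
qed

lemmas \<Phi>_powers = powers(1)[OF \<phi>_carrier, folded \<Phi>_def, unfolded ord_\<phi>]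
lemmas inj_\<phi> = powers(2)[OF \<phi>_carrier, unfolded ord_\<phi>]

lemma subgroup_\<Phi>: "subgroup \<Phi> (mult_of R)"
  unfolding \<Phi>_def using M.generate_is_subgroup[of "{\<phi>}"] \<phi>_carrier by simp

lemma \<Phi>_carrier: "\<Phi> \<subseteq> carrier R - {\<zero>}"
  using subgroup.subset[OF subgroup_\<Phi>] by simp

lemma card_\<Phi>: "card \<Phi> = k"
  by (simp add: \<Phi>_powers card_image inj_\<phi>)

lemma finite_\<Phi>: "finite \<Phi>"
  by (simp add: \<Phi>_powers)

lemma \<Phi>_mult: "x \<in> \<Phi> \<Longrightarrow> y \<in> \<Phi> \<Longrightarrow> x \<otimes> y \<in> \<Phi>"
  using subgroup.m_closed[OF subgroup_\<Phi>] by simp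

lemma \<Phi>_one: "\<one> \<in> \<Phi>"
  using subgroup.one_closed[OF subgroup_\<Phi>] by simp

lemma \<Phi>_inv:
  assumes "x \<in> \<Phi>" shows "inv x \<in> \<Phi>"
  using subgroup.m_inv_closed[OF subgroup_\<Phi> assms] assms \<Phi>_carrier
  by (simp add: m_inv_mult_of subset_iff)

section \<open>The power map with exponent \<open>m\<close>\<close>

lemma pow_m_gen: "(\<zeta> [^] (i::nat)) [^] m = \<phi> [^] (i mod k)"
proof -
  have c: "\<zeta> \<in> carrier R" "\<phi> \<in> carrier R" using gen_carrier \<phi>_carrier by auto
  have "(\<zeta> [^] i) [^] m = \<phi> [^] i"
    unfolding \<phi>_def using c by (simp add: nat_pow_pow mult.commute)
  \<comment> \<open>Division with remainder: the multiple of \<open>k\<close> drops out because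
    \<phi> has order \<open>k\<close>.\<close>
  also have "\<dots> = \<phi> [^] (k * (i div k) + i mod k)" by simp
  also have "\<dots> = (\<phi> [^] k) [^] (i div k) \<otimes> \<phi> [^] (i mod k)"
    using c by (simp only: nat_pow_pow nat_pow_mult)
  also have "\<phi> [^] k = \<one>" using M.pow_ord_eq_1[OF \<phi>_carrier] by (simp add: ord_\<phi>)
  finally show ?thesis using c by (simp add: nat_pow_one)
qed

lemma pow_m_0_iff:
  assumes "x \<in> carrier R" shows "x [^] m = \<zero> \<longleftrightarrow> x = \<zero>"
  using assms m_pos M.nat_pow_closed[of x m] nat_pow_zero[of m] by auto

text \<open>On exponents of \<zeta> the map is reduction mod \<open>k\<close>, so a fibre is a
  residue class among the exponents below \<open>k * m\<close>.\<close>

lemma card_pow_m_fibre: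
  assumes "u \<in> \<Phi>"
  shows "card {x \<in> carrier R. x [^] m = u} = m"
proof -
  obtain j where j: "j < k" "u = \<phi> [^] j" using assms by (auto simp: \<Phi>_powers)
  have carr: "carrier R - {\<zero>} = (\<lambda>i. \<zeta> [^] i) ` {..<k * m}"
    and inj: "inj_on (\<lambda>i::nat. \<zeta> [^] i) {..<k * m}"
    using powers[OF gen_carrier] gen by (simp_all add: ord_\<zeta>)
  have "u \<noteq> \<zero>" using assms \<Phi>_carrier by auto
  have "{x \<in> carrier R. x [^] m = u} = {x \<in> carrier R - {\<zero>}. x [^] m = u}"
    using \<open>u \<noteq> \<zero>\<close> pow_m_0_iff by auto
  also have "\<dots> = (\<lambda>i. \<zeta> [^] i) ` {i \<in> {..<k * m}. i mod k = j}"
    \<comment> \<open>Both \<open>i mod k\<close> and \<open>j\<close> are below \<open>k\<close>,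
      where powers of \<phi> are distinct, so equal powers force equal exponents.\<close>
    unfolding carr using inj_onD[OF inj_\<phi>] j k_pos by (auto simp: pow_m_gen)
  finally have "card {x \<in> carrier R. x [^] m = u} = card {i \<in> {..<k * m}. i mod k = j}"
    using inj by (simp add: card_image inj_on_def)
  then show ?thesis using card_mod_class[OF j(1)] by simp
qed

lemma pow_m_image: "(\<lambda>x. x [^] m) ` carrier R \<subseteq> insert \<zero> \<Phi>"
proof (intro image_subsetI)
  fix x assume x: "x \<in> carrier R"
  show "x [^] m \<in> insert \<zero> \<Phi>"
  proof (cases "x = \<zero>")
    case True then show ?thesis using pow_m_0_iff x by auto
  next
    case False
    then obtain i :: nat where "x = \<zeta> [^] i" using powers(1)[OF gen_carrier] gen x by auto
    then show ?thesis using k_pos by (auto simp: pow_m_gen \<Phi>_powers)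
  qed
qed

section \<open>When -1 lies in \<Phi>\<close>

lemma mem_\<Phi>_iff:
  assumes "x \<in> carrier R - {\<zero>}" shows "x \<in> \<Phi> \<longleftrightarrow> x [^] k = \<one>"
proof
  assume "x \<in> \<Phi>"
  then obtain i :: nat where "x = \<phi> [^] i" by (auto simp: \<Phi>_powers)
  then have "x [^] k = \<phi> [^] (k * i)" using \<phi>_carrier by (simp add: nat_pow_pow mult.commute)
  then show "x [^] k = \<one>" using M.pow_eq_id[OF \<phi>_carrier] ord_\<phi> by auto
next
  assume *: "x [^] k = \<one>"
  obtain i :: nat where i: "x = \<zeta> [^] i" using powers(1)[OF gen_carrier] gen assms by auto
  then have "\<zeta> [^] (i * k) = \<one>" using * gen_carrier by (simp add: nat_pow_pow)
  \<comment> \<open>Cancelling \<open>k\<close> leaves \<open>m dvd i\<close>, which makes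
    \<open>x\<close> a power of \<phi>.\<close>
  then have "k * m dvd i * k" using M.pow_eq_id[OF gen_carrier] ord_\<zeta> by auto
  then obtain l where "i = m * l" using k_pos by auto
  then have "x = \<phi> [^] l" unfolding i \<phi>_def using gen_carrier by (simp add: nat_pow_pow)
  then show "x \<in> \<Phi>" unfolding \<Phi>_def
    using M.generate_pow_on_finite_carrier[OF _ \<phi>_carrier] finite_R by auto
qed

lemma minus_one_pow: "(\<ominus> \<one>) [^] (n::nat) = (if even n then \<one> else \<ominus> \<one>)"
  by (induction n) (auto simp: l_minus r_minus)

lemma minus_one_nonzero: "\<ominus> \<one> \<in> carrier R - {\<zero>}"
  by (metis Diff_iff a_inv_closed minus_minus minus_zero one_closed one_not_zero singletonD)

text \<open>The criterion asks for \<open>(\<ominus> \<one>) [^] k = \<one>\<close>: automatic for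
  even \<open>k\<close>, while for odd \<open>k\<close> the power is -1 itself.\<close>

lemma minus_one_mem_\<Phi>: "\<ominus> \<one> \<in> \<Phi> \<longleftrightarrow> even k \<or> \<ominus> \<one> = \<one>"
  using mem_\<Phi>_iff[OF minus_one_nonzero] by (simp add: minus_one_pow)

text \<open>For even order the unit group has odd order, and raising -1 to that order gives -1 = 1.
  For odd order, \<zeta> to half the group order is a square root of 1 other than 1, hence is -1, so
  -1 differs from 1.\<close>

lemma minus_one_eq_one_iff: "\<ominus> \<one> = \<one> \<longleftrightarrow> even (order R)"
proof -
  have "order R > 0" using finite_R order_gt_0_iff_finite by blast
  then have order_R: "order R = Suc (k * m)" using order_eq by simp
  show ?thesis
  proof (cases "even (order R)")
    case True
    then have "odd (k * m)" using order_R by simp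
    moreover have "(\<ominus> \<one>) [^] (k * m) = \<one>"
      using M.pow_order_eq_1[OF minus_one_nonzero] order_mult_of[OF finite_R] order_eq by simp
    ultimately show ?thesis using True by (simp add: minus_one_pow)
  next
    case False
    then have "even (k * m)" using order_R by simp
    then obtain h where h: "k * m = 2 * h" by blast
    have c: "\<zeta> [^] h \<in> carrier R" using gen_carrier by simp
    have "\<zeta> [^] h \<otimes> \<zeta> [^] h = \<zeta> [^] (k * m)"
      using gen_carrier h by (simp add: nat_pow_mult mult_2)
    also have "\<dots> = \<one>" using M.pow_ord_eq_1[OF gen_carrier] ord_\<zeta> by simp
    finally have "\<zeta> [^] h = \<one> \<or> \<zeta> [^] h = \<ominus> \<one>" using square_eq_one[OF c] by blast
    moreover have "k * m > 0" using k_pos m_pos by simp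
    then have "h > 0" "h < k * m" using h by linarith+
    then have "\<not> k * m dvd h" using nat_dvd_not_less by blast
    then have "\<zeta> [^] h \<noteq> \<one>" using M.pow_eq_id[OF gen_carrier] ord_\<zeta> by simp
    ultimately show ?thesis using False by auto
  qed
qed

section \<open>Solutions with two or three nonzero entries\<close>

lemma diff_eq_iff:
  assumes "x \<in> carrier R" "y \<in> carrier R" "z \<in> carrier R"
  shows "x \<ominus> y = z \<longleftrightarrow> x = z \<oplus> y"
proof -
  have "(x \<ominus> y) \<oplus> y = x" "(z \<oplus> y) \<ominus> y = z"
    using assms by (simp_all add: minus_eq a_assoc l_neg r_neg)
  then show ?thesis by metis
qed

lemma \<Phi>_closed: "x \<in> \<Phi> \<Longrightarrow> x \<in> carrier R"
  using \<Phi>_carrier by auto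

lemma zero_not_mem_\<Phi>: "\<zero> \<notin> \<Phi>"
  using \<Phi>_carrier by auto

text \<open>A pair is determined by \<open>v = w \<oplus> \<one>\<close>, a common element of \<Phi>
  and its translate. This handles the triples whose only zero is the first or the second
  entry.\<close>

lemma card_diff_pairs:
  "card {(v, w) \<in> \<Phi> \<times> \<Phi>. v \<ominus> w = \<one>} = card (\<Phi> \<inter> (\<Phi> +> \<one>))"
proof (rule bij_betw_same_card)
  show "bij_betw fst {(v, w) \<in> \<Phi> \<times> \<Phi>. v \<ominus> w = \<one>} (\<Phi> \<inter> (\<Phi> +> \<one>))"
  proof (rule bij_betw_byWitness[where f' = "\<lambda>v. (v, v \<ominus> \<one>)"])
    show "\<forall>a\<in>{(v, w) \<in> \<Phi> \<times> \<Phi>. v \<ominus> w = \<one>}. (fst a, fst a \<ominus> \<one>) = a"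
      by (auto simp: diff_eq_iff \<Phi>_closed a_comm)
    show "fst ` {(v, w) \<in> \<Phi> \<times> \<Phi>. v \<ominus> w = \<one>} \<subseteq> \<Phi> \<inter> (\<Phi> +> \<one>)"
      by (auto simp: a_r_coset_def' diff_eq_iff \<Phi>_closed a_comm)
    show "(\<lambda>v. (v, v \<ominus> \<one>)) ` (\<Phi> \<inter> (\<Phi> +> \<one>)) \<subseteq> {(v, w) \<in> \<Phi> \<times> \<Phi>. v \<ominus> w = \<one>}"
    proof
      fix x assume "x \<in> (\<lambda>v. (v, v \<ominus> \<one>)) ` (\<Phi> \<inter> (\<Phi> +> \<one>))"
      then obtain w where w: "w \<in> \<Phi>" "w \<oplus> \<one> \<in> \<Phi>" "x = (w \<oplus> \<one>, (w \<oplus> \<one>) \<ominus> \<one>)"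
        by (auto simp: a_r_coset_def')
      have "(w \<oplus> \<one>) \<ominus> \<one> = w" "(w \<oplus> \<one>) \<ominus> w = \<one>"
        using \<Phi>_closed[OF w(1)] by (simp_all add: diff_eq_iff a_comm)
      then show "x \<in> {(v, w) \<in> \<Phi> \<times> \<Phi>. v \<ominus> w = \<one>}" using w by simp
    qed
  qed auto
qed

text \<open>Dividing \<open>u + v = 1\<close> by \<open>u\<close> turns it into \<open>1/u - v/u = 1\<close>, whether or not \<open>-1 \<in> \<Phi>\<close>.\<close>
lemma card_sum_pairs:
  "card {(u, v) \<in> \<Phi> \<times> \<Phi>. u \<oplus> v = \<one>} = card {(v, w) \<in> \<Phi> \<times> \<Phi>. v \<ominus> w = \<one>}"
proof (rule bij_betw_same_card)
  have inv: "inv x \<in> carrier R" "inv x \<otimes> x = \<one>" "x \<otimes> inv x = \<one>" "inv (inv x) = x"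
    if "x \<in> \<Phi>" for x
  proof -
    have "x \<in> Units R" using that \<Phi>_carrier field_Units by auto
    then show "inv x \<in> carrier R" "inv x \<otimes> x = \<one>" "x \<otimes> inv x = \<one>" "inv (inv x) = x"
      by simp_all
  qed
  show "bij_betw (\<lambda>(u, v). (inv u, v \<otimes> inv u))
      {(u, v) \<in> \<Phi> \<times> \<Phi>. u \<oplus> v = \<one>} {(v, w) \<in> \<Phi> \<times> \<Phi>. v \<ominus> w = \<one>}"
  \<comment> \<open>The inverse has the same formula: the reciprocal of \<open>1/u\<close> is
    \<open>u\<close>, and \<open>(v/u) * u = v\<close>.\<close>
  proof (rule bij_betw_byWitness[where f' = "\<lambda>(v, w). (inv v, w \<otimes> inv v)"])
    show "(\<lambda>(u, v). (inv u, v \<otimes> inv u)) ` {(u, v) \<in> \<Phi> \<times> \<Phi>. u \<oplus> v = \<one>}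
        \<subseteq> {(v, w) \<in> \<Phi> \<times> \<Phi>. v \<ominus> w = \<one>}"
    proof clarsimp
      fix u v assume *: "u \<in> \<Phi>" "v \<in> \<Phi>" "u \<oplus> v = \<one>"
      have "(u \<oplus> v) \<otimes> inv u = \<one> \<oplus> v \<otimes> inv u"
        using *(1,2) by (simp add: l_distr \<Phi>_closed inv)
      then have "inv u = \<one> \<oplus> v \<otimes> inv u" using * inv(1) by (metis l_one)
      then show "inv u \<in> \<Phi> \<and> v \<otimes> inv u \<in> \<Phi> \<and> inv u \<ominus> v \<otimes> inv u = \<one>"
        using * by (simp add: \<Phi>_inv \<Phi>_mult diff_eq_iff \<Phi>_closed inv)
    qed
    show "(\<lambda>(v, w). (inv v, w \<otimes> inv v)) ` {(v, w) \<in> \<Phi> \<times> \<Phi>. v \<ominus> w = \<one>}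
        \<subseteq> {(u, v) \<in> \<Phi> \<times> \<Phi>. u \<oplus> v = \<one>}"
    proof clarsimp
      fix v w assume *: "v \<in> \<Phi>" "w \<in> \<Phi>" "v \<ominus> w = \<one>"
      then have "v = \<one> \<oplus> w" by (simp add: diff_eq_iff \<Phi>_closed)
      then have "v \<otimes> inv v = inv v \<oplus> w \<otimes> inv v"
        using * by (metis l_distr l_one one_closed \<Phi>_closed inv(1))
      then show "inv v \<in> \<Phi> \<and> w \<otimes> inv v \<in> \<Phi> \<and> inv v \<oplus> w \<otimes> inv v = \<one>"
        using * by (simp add: \<Phi>_inv \<Phi>_mult inv)
    qed
  qed (auto simp: inv \<Phi>_closed m_assoc)
qed

text \<open>Record \<open>v\<close> and the common value
  \<open>y = u \<oplus> v = w \<oplus> \<one>\<close>; subtraction recovers \<open>u\<close> and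
  \<open>w\<close>. Then \<open>v\<close> runs over the powers of \<phi>.\<close>

lemma card_triples_\<Phi>:
  "card {(u, v, w) \<in> \<Phi> \<times> \<Phi> \<times> \<Phi>. u \<oplus> v \<ominus> w = \<one>}
    = k + (\<Sum>j = 1..k - 1. card ((\<Phi> +> \<one>) \<inter> (\<Phi> +> (\<phi> [^] j))))"
proof -
  let ?S = "\<lambda>v. (\<Phi> +> \<one>) \<inter> (\<Phi> +> v)"
  have "bij_betw (\<lambda>(u, v, w). (v, w \<oplus> \<one>)) {(u, v, w) \<in> \<Phi> \<times> \<Phi> \<times> \<Phi>. u \<oplus> v \<ominus> w = \<one>} (Sigma \<Phi> ?S)"
  proof (rule bij_betw_byWitness[where f' = "\<lambda>(v, y). (y \<ominus> v, v, y \<ominus> \<one>)"])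
    show "\<forall>x\<in>{(u, v, w) \<in> \<Phi> \<times> \<Phi> \<times> \<Phi>. u \<oplus> v \<ominus> w = \<one>}.
        (case case x of (u, v, w) \<Rightarrow> (v, w \<oplus> \<one>) of (v, y) \<Rightarrow> (y \<ominus> v, v, y \<ominus> \<one>)) = x"
      by (auto simp: diff_eq_iff \<Phi>_closed a_comm)
    show "\<forall>x\<in>Sigma \<Phi> ?S.
        (case case x of (v, y) \<Rightarrow> (y \<ominus> v, v, y \<ominus> \<one>) of (u, v, w) \<Rightarrow> (v, w \<oplus> \<one>)) = x"
      by (auto simp: a_r_coset_def' minus_eq a_assoc l_neg r_neg \<Phi>_closed)
    show "(\<lambda>(u, v, w). (v, w \<oplus> \<one>)) ` {(u, v, w) \<in> \<Phi> \<times> \<Phi> \<times> \<Phi>. u \<oplus> v \<ominus> w = \<one>} \<subseteq> Sigma \<Phi> ?S"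
      by (auto simp: a_r_coset_def' diff_eq_iff \<Phi>_closed a_comm)
    show "(\<lambda>(v, y). (y \<ominus> v, v, y \<ominus> \<one>)) ` Sigma \<Phi> ?S
        \<subseteq> {(u, v, w) \<in> \<Phi> \<times> \<Phi> \<times> \<Phi>. u \<oplus> v \<ominus> w = \<one>}"
    proof clarsimp
      fix v y assume *: "v \<in> \<Phi>" "y \<in> \<Phi> +> \<one>" "y \<in> \<Phi> +> v"
      then obtain u w where u: "u \<in> \<Phi>" "y = u \<oplus> v" and w: "w \<in> \<Phi>" "y = w \<oplus> \<one>"
        by (auto simp: a_r_coset_def')
      then have "y \<ominus> v = u" "y \<ominus> \<one> = w"
        using * by (auto simp: diff_eq_iff \<Phi>_closed)
      moreover have "u \<oplus> v \<ominus> w = \<one>"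
        using u w *(1) by (simp add: diff_eq_iff \<Phi>_closed a_comm)
      ultimately show "y \<ominus> v \<in> \<Phi> \<and> y \<ominus> \<one> \<in> \<Phi> \<and> y \<ominus> v \<oplus> v \<ominus> (y \<ominus> \<one>) = \<one>"
        using u w by simp
    qed
  qed
  then have "card {(u, v, w) \<in> \<Phi> \<times> \<Phi> \<times> \<Phi>. u \<oplus> v \<ominus> w = \<one>} = card (Sigma \<Phi> ?S)"
    by (rule bij_betw_same_card)
  also have "\<dots> = (\<Sum>v\<in>\<Phi>. card (?S v))"
    by (rule card_SigmaI) (auto simp: finite_\<Phi> a_r_coset_def')
  also have "\<dots> = (\<Sum>j<k. card (?S (\<phi> [^] j)))"
    unfolding \<Phi>_powers by (subst sum.reindex[OF inj_\<phi>]) simp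
  \<comment> \<open>Exponent 0 means \<open>v = \<one>\<close>, where the two translates coincide
    and contribute \<open>k\<close>.\<close>
  also have "{..<k} = insert 0 {1..k - 1}" using k_pos by auto
  also have "(\<Sum>j\<in>insert 0 {1..k - 1}. card (?S (\<phi> [^] j)))
      = card (\<Phi> +> \<one>) + (\<Sum>j = 1..k - 1. card (?S (\<phi> [^] j)))" by simp
  also have "card (\<Phi> +> \<one>) = k"
  proof -
    have "\<Phi> +> \<one> = (\<lambda>x. x \<oplus> \<one>) ` \<Phi>" by (auto simp: a_r_coset_def')
    then show ?thesis by (simp add: card_image inj_on_def card_\<Phi> \<Phi>_closed)
  qed
  finally show ?thesis .
qed

section \<open>The weighted sum over the zero patterns\<close>

lemma card_solutions:
  "card {(x, y, z) \<in> carrier R \<times> carrier R \<times> carrier R. x [^] m \<oplus> y [^] m \<ominus> z [^] m = \<one>}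
    = m ^ 3 * (k + (\<Sum>j = 1..k - 1. card ((\<Phi> +> \<one>) \<inter> (\<Phi> +> (\<phi> [^] j)))))
      + 3 * m\<^sup>2 * card (\<Phi> \<inter> (\<Phi> +> \<one>)) + (if \<ominus> \<one> \<in> \<Phi> then 3 else 2) * m"
proof -
  define c where "c u = card {x \<in> carrier R. x [^] m = u}" for u
  have c_\<Phi>: "c u = m" if "u \<in> \<Phi>" for u using card_pow_m_fibre[OF that] by (simp add: c_def)
  have "{x \<in> carrier R. x [^] m = \<zero>} = {\<zero>}" using pow_m_0_iff by auto
  \<comment> \<open>A zero entry thus contributes the factor 1, a nonzero one the factor
    \<open>m\<close>.\<close>
  then have c_0: "c \<zero> = 1" by (simp add: c_def)
  define g where "g = (\<lambda>(u, v, w). c u * c v * c w)"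
  let ?B = "insert \<zero> \<Phi>"
  define T where "T = {(u, v, w) \<in> ?B \<times> ?B \<times> ?B. u \<oplus> v \<ominus> w = \<one>}"
  define X where "X = {(u, v, w) \<in> \<Phi> \<times> \<Phi> \<times> \<Phi>. u \<oplus> v \<ominus> w = \<one>}"
  define D where "D = {(v, w) \<in> \<Phi> \<times> \<Phi>. v \<ominus> w = \<one>}"
  define S where "S = {(u, v) \<in> \<Phi> \<times> \<Phi>. u \<oplus> v = \<one>}"
  \<comment> \<open>\<open>X\<close> has no zero entry; \<open>X1\<close>, \<open>X2\<close>,
    \<open>X3\<close> have their only zero in that position; \<open>Y\<close> and \<open>Z\<close>
    have two zeros.\<close>
  define X1 where "X1 = (\<lambda>(v, w). (\<zero>, v, w)) ` D"
  define X2 where "X2 = (\<lambda>(u, w). (u, \<zero>, w)) ` D"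
  define X3 where "X3 = (\<lambda>(u, v). (u, v, \<zero>)) ` S"
  define Y where "Y = {(\<one>, \<zero>, \<zero>), (\<zero>, \<one>, \<zero>)}"
  define Z where "Z = (if \<ominus> \<one> \<in> \<Phi> then {(\<zero>, \<zero>, \<ominus> \<one>)} else {})"
  note defs = X_def D_def S_def X1_def X2_def X3_def Y_def Z_def
  have "finite (\<Phi> \<times> \<Phi>)" "finite (\<Phi> \<times> \<Phi> \<times> \<Phi>)" using finite_\<Phi> by auto
  then have fin: "finite X" "finite D" "finite S"
    by (auto simp: X_def D_def S_def elim!: finite_subset[rotated])
  have T: "T = X \<union> X1 \<union> X2 \<union> X3 \<union> Y \<union> Z"
  proof -
    have neg: "\<zero> \<ominus> w = \<one> \<longleftrightarrow> w = \<ominus> \<one>" if "w \<in> \<Phi>" for w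
      using \<Phi>_closed[OF that] by (metis minus_eq l_zero minus_minus one_closed a_inv_closed)
    \<comment> \<open>Three zero entries would give 0 = 1.\<close>
    have "T \<subseteq> X \<union> X1 \<union> X2 \<union> X3 \<union> Y \<union> Z"
      using zero_not_one neg by (auto simp: T_def defs minus_eq \<Phi>_closed image_def)
    moreover have "X \<union> X1 \<union> X2 \<union> X3 \<union> Y \<union> Z \<subseteq> T"
      using \<Phi>_one by (auto simp: T_def defs minus_eq \<Phi>_closed split: if_splits)
    ultimately show ?thesis by (rule equalityI)
  qed
  have sums: "sum g X = card X * m ^ 3" "sum g X1 = card D * m\<^sup>2" "sum g X2 = card D * m\<^sup>2"
    "sum g X3 = card S * m\<^sup>2" "sum g Y = 2 * m" "sum g Z = (if \<ominus> \<one> \<in> \<Phi> then 1 else 0) * m"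
  proof -
    \<comment> \<open>The weight is constant on each class, since it depends only on the number of
      zeros.\<close>
    have const: "sum g A = card A * n" if "\<And>x. x \<in> A \<Longrightarrow> g x = n" for A n
      using that by simp
    have cards: "card X1 = card D" "card X2 = card D" "card X3 = card S"
      unfolding X1_def X2_def X3_def by (auto intro!: card_image simp: inj_on_def)
    show "sum g X = card X * m ^ 3"
      by (rule const) (auto simp: g_def X_def c_\<Phi> power3_eq_cube)
    show "sum g X1 = card D * m\<^sup>2" unfolding cards(1)[symmetric]
      by (rule const) (auto simp: g_def X1_def D_def c_\<Phi> c_0 power2_eq_square)
    show "sum g X2 = card D * m\<^sup>2" unfolding cards(2)[symmetric]
      by (rule const) (auto simp: g_def X2_def D_def c_\<Phi> c_0 power2_eq_square)
    show "sum g X3 = card S * m\<^sup>2" unfolding cards(3)[symmetric]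
      by (rule const) (auto simp: g_def X3_def S_def c_\<Phi> c_0 power2_eq_square)
    show "sum g Y = 2 * m" by (simp add: Y_def g_def c_0 c_\<Phi> \<Phi>_one)
    show "sum g Z = (if \<ominus> \<one> \<in> \<Phi> then 1 else 0) * m"
      by (simp add: Z_def g_def c_0 c_\<Phi>)
  qed
  have "card {(x, y, z) \<in> carrier R \<times> carrier R \<times> carrier R. x [^] m \<oplus> y [^] m \<ominus> z [^] m = \<one>}
      = sum g T"
    using card_triples_by_fibres[OF finite_R, of ?B "\<lambda>x. x [^] m" "\<lambda>u v w. u \<oplus> v \<ominus> w = \<one>"]
      finite_\<Phi> pow_m_image by (simp add: T_def g_def c_def)
  also have "\<dots> = sum g X + sum g X1 + sum g X2 + sum g X3 + sum g Y + sum g Z"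
  proof -
    have "finite X1" "finite X2" "finite X3" "finite Y" "finite Z"
      using fin by (auto simp: X1_def X2_def X3_def Y_def Z_def)
    \<comment> \<open>The zero patterns of the classes differ because \<Phi> omits zero. The unions
      accumulate as in the nesting of \<open>T\<close>.\<close>
    moreover have "X \<inter> X1 = {}" "(X \<union> X1) \<inter> X2 = {}" "(X \<union> X1 \<union> X2) \<inter> X3 = {}"
      "(X \<union> X1 \<union> X2 \<union> X3) \<inter> Y = {}" "(X \<union> X1 \<union> X2 \<union> X3 \<union> Y) \<inter> Z = {}"
      using zero_not_mem_\<Phi> by (auto simp: defs split: if_splits)
    ultimately show ?thesis unfolding T using fin by (simp add: sum.union_disjoint)
  qed
  also have "\<dots> = m ^ 3 * card X + 3 * m\<^sup>2 * card D + (if \<ominus> \<one> \<in> \<Phi> then 3 else 2) * m"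
    using card_sum_pairs unfolding sums by (simp add: S_def D_def algebra_simps)
  finally show ?thesis using card_triples_\<Phi> card_diff_pairs by (simp add: X_def D_def)
qed

end

section \<open>Specialisation to order \<open>p ^ r\<close>\<close>

theorem theorem17:
  fixes F :: "('a, 'b) ring_scheme" (structure)
    and p r q k m s t :: nat
    and \<zeta> \<phi> :: 'a
    and \<Phi> :: "'a set"
  assumes "Factorial_Ring.prime p"
    and "r \<ge> 1"
    and "q = p ^ r"
    and "is_GF F q"
    and "k \<ge> 3"
    and "k dvd q - 1"
    and "m = (q - 1) div k"
    and "\<zeta> \<in> carrier (Multiplicative_Group.mult_of F)"
    and "generate (Multiplicative_Group.mult_of F) {\<zeta>} = carrier (Multiplicative_Group.mult_of F)"
    and "\<phi> = \<zeta> [^] m"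
    and "\<Phi> = generate (Multiplicative_Group.mult_of F) {\<phi>}"
    and "s = (\<Sum>j = 1..k - 1. card ((\<Phi> +> \<one>) \<inter> (\<Phi> +> (\<phi> [^] j))))"
    and "t = card (\<Phi> \<inter> (\<Phi> +> \<one>))"
    and "circular_pair p k"
  shows "card {(x, y, z) \<in> carrier F \<times> carrier F \<times> carrier F.
           x [^] m \<oplus> y [^] m \<ominus> z [^] m = \<one>} =
         (if odd k \<and> p \<noteq> 2 then m ^ 3 * (k + s) + 3 * m ^ 2 * t + 2 * m
          else m ^ 3 * (k + s) + 3 * m ^ 2 * t + 3 * m)"
proof -
  interpret field F using assms(4) by (simp add: is_GF_def)
  have fin: "finite (carrier F)" and ord: "order F = q" using assms(4) by (auto simp: is_GF_def)
  \<comment> \<open>This makes \<open>q - 1\<close> positive, so that \<open>m\<close> is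
    nonzero.\<close>
  have "q \<ge> 2" using assms(1-3) prime_ge_2_nat[of p] self_le_power[of p r] by simp
  have km: "q - 1 = k * m" using assms(6,7) by simp
  have "k > 0" "m > 0" using km \<open>q \<ge> 2\<close> assms(5) by (auto intro!: Nat.gr0I)
  then interpret G: finite_field_gen F \<zeta> k m
    using fin ord km assms(8,9) by unfold_locales simp_all
  have "\<phi> = G.\<phi>" by (simp add: G.\<phi>_def assms(10))
  moreover from this have "\<Phi> = G.\<Phi>" by (simp add: G.\<Phi>_def assms(11))
  \<comment> \<open>The parity of the field order turns the condition -1 = 1 into
    \<open>p = 2\<close>, matching the case split.\<close>
  moreover have "even q \<longleftrightarrow> p = 2"
    using assms(1-3) primes_dvd_imp_eq[of 2 p] by (auto simp: two_is_prime_nat)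
  then have "\<ominus> \<one> \<in> G.\<Phi> \<longleftrightarrow> even k \<or> p = 2"
    by (simp add: G.minus_one_mem_\<Phi> G.minus_one_eq_one_iff ord)
  ultimately show ?thesis using G.card_solutions assms(12,13) by auto
qed

end
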